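(* Let $r\ge 2$ be a fixed integer and let $p=p(n)$ satisfy either \[ \frac{\sqrt{\log n}}{n^{(r-1)/4}}\ll p = o(1) \qquad\text{or}\qquad \Omega\!\left(\frac{(\log n)^{r-1}}{n^{r-1}}\right) = p \ll \frac{1}{n^{(r-1)/2}}. \] Then, a.a.s., \[ \ell_{\max} = \Theta\!\left(np^{1/(r-1)}\right), \] where $\ell_{\max}$ is the maximal length of an ordered loose path in the random $r$-uniform hypergraph $H^{(r)}(n,p)$.
   Context: Let $r\ge 2$ be a fixed integer (constant). $H=H^{(r)}(n,p)$ is the random $r$-uniform hypergraph on the vertex set $[n]=\{1,\dots,n\}$ in which each $r$-element subset of $[n]$ is included as an edge independently with probability $p=p(n)\in[0,1]$. An ordered loose path of length $\ell$ in $H$ is an increasing sequence of vertices $v_1<v_2<\dots<v_{\ell(r-1)+1}$ in $[n]$ such that the $\ell$ sets $\{v_{(k-1)(r-1)+1},v_{(k-1)(r-1)+2},\dots,v_{k(r-1)+1}\}$, $k=1,\dots,\ell$, are all edges of $H$ (so every two consecutive edges intersect in a single vertex). $\ell_{\max}$ denotes the maximal length of an ordered loose path in $H$. All asymptotics are as $n\to\infty$; "a.a.s." means with probability tending to $1$ as $n\to\infty$. $A_n\ll B_n$ means $A_n/B_n\to0$ as $n\to\infty$; $\Omega(g(n))=p$ means $p\ge c\,g(n)$ for some constant $c>0$ and all large $n$. "A.a.s. $\ell_{\max}=\Theta(g(n))$" means that there are constants $0<c\le C$ (not depending on $n$) such that a.a.s. $c\,g(n)\le\ell_{\max}\le C\,g(n)$.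 *)

theory Defs
  imports "HOL-Probability.Probability" "HOL-Probability.Product_PMF" "HOL-Library.Landau_Symbols"
begin

definition r_subsets :: "nat \<Rightarrow> nat \<Rightarrow> nat set set" where
  "r_subsets r n = {e. e \<subseteq> {1..n} \<and> card e = r}"

text \<open>The edge set of the random \<open>r\<close>-uniform hypergraph on the vertex set \<open>{1..n}\<close>: independent
  Bernoulli indicators, one for each \<open>r\<close>-subset of the vertex set. Since \<^const>\<open>bernoulli_pmf\<close>
  clamps its parameter to the unit interval, this is meant for \<open>0 \<le> q \<le> 1\<close> only.\<close>

definition random_hypergraph :: "nat \<Rightarrow> nat \<Rightarrow> real \<Rightarrow> nat set set pmf" where
  "random_hypergraph r n q =
     map_pmf (\<lambda>\<omega>. {e \<in> r_subsets r n. \<omega> e})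
       (Pi_pmf (r_subsets r n) False (\<lambda>_. bernoulli_pmf q))"

text \<open>\<open>v 1 < \<dots> < v (l * (r - 1) + 1)\<close> is the vertex sequence of an ordered loose path with \<open>l\<close> edges;
  the values of \<open>v\<close> outside this index range are irrelevant.\<close>

definition ordered_loose_path ::
    "nat \<Rightarrow> nat \<Rightarrow> nat set set \<Rightarrow> nat \<Rightarrow> (nat \<Rightarrow> nat) \<Rightarrow> bool" where
  "ordered_loose_path r n E l v \<longleftrightarrow>
     strict_mono_on {1..l * (r - 1) + 1} v \<and>
     v ` {1..l * (r - 1) + 1} \<subseteq> {1..n} \<and>
     (\<forall>k\<in>{1..l}. v ` {(k - 1) * (r - 1) + 1..k * (r - 1) + 1} \<in> E)"

text \<open>For \<open>r \<ge> 2\<close> and \<open>n \<ge> 1\<close> the set below is finite and nonempty: a single vertex is a path of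
  length \<open>0\<close>, so the value is \<open>0\<close> if there are no edges.\<close>

definition max_path_length :: "nat \<Rightarrow> nat \<Rightarrow> nat set set \<Rightarrow> nat" where
  "max_path_length r n E = Max {l. \<exists>v. ordered_loose_path r n E l v}"

definition aas :: "(nat \<Rightarrow> 'a pmf) \<Rightarrow> (nat \<Rightarrow> 'a \<Rightarrow> bool) \<Rightarrow> bool" where
  "aas M P \<longleftrightarrow> (\<lambda>n. measure_pmf.prob (M n) {x. P n x}) \<longlonglongrightarrow> 1"

end

theory Submission
  imports Defs "HOL-Real_Asymp.Real_Asymp"
begin

text \<open>Write \<open>d = r - 1\<close> and \<open>x = n p\<^sup>1\<^sup>/\<^sup>d\<close>; all that is used about \<open>p\<close> is that \<open>x\<close> is at least of
  order \<open>ln n\<close>, which holds in both regimes.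

  Lower bound: build a path greedily from vertex \<open>1\<close>, always continuing along an edge whose least
  vertex is the current one and whose greatest vertex is as small as possible. Edges with distinct
  least vertices are independent, and a step is longer than \<open>j\<close> with probability
  \<open>(1 - p)\<close> to the power \<open>j choose d\<close>, so steps have size of order \<open>p\<^sup>-\<^sup>1\<^sup>/\<^sup>d\<close> with an exponential
  tail. A Chernoff bound shows that a suitable multiple of \<open>x\<close> steps fit into \<open>{1..n}\<close>, except with
  probability exponentially small in \<open>x\<close>.

  Upper bound: with \<open>m = l d + 1\<close>, the expected number of paths of length \<open>l\<close> is
  \<open>(n choose m) p\<^sup>l \<le> (e x / m)\<^sup>m n / x\<close>, which is at most \<open>1 / x\<close> once \<open>l\<close> is a large multiple
  of \<open>x\<close>, because then \<open>l \<ge> ln n\<close>.\<close>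

section \<open>Product structure of the random hypergraph\<close>

lemma finite_r_subsets [simp]: "finite (r_subsets r n)"
  by (rule finite_subset[of _ "Pow {1..n}"]) (auto simp: r_subsets_def)

text \<open>The hypotheses say that \<open>X\<close> depends only on the edges in \<open>S\<close>
  and \<open>Y\<close> only on those outside \<open>S\<close>. The product measure splits into
  independent factors over these two sets of coordinates, where the events become cylinders.\<close>

lemma prob_random_hypergraph_indep:
  assumes X: "\<And>E. X (E \<inter> S) = X E" and Y: "\<And>E. Y (E - S) = Y E"
  shows "measure_pmf.prob (random_hypergraph r n q) {E. X E \<and> Y E} =
    measure_pmf.prob (random_hypergraph r n q) {E. X E} *
    measure_pmf.prob (random_hypergraph r n q) {E. Y E}"
proof -
  define U where "U = r_subsets r n"
  define M where "M A = Pi_pmf A False (\<lambda>_. bernoulli_pmf q)" for A :: "nat set set"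
  let ?E = "\<lambda>\<omega>. {e \<in> U. \<omega> e}"
  let ?h = "\<lambda>(f, g) x. if x \<in> U \<inter> S then f x else g x :: bool"
  define R where "R fg = ?E (?h fg)" for fg
  have fin: "finite U" by (simp add: U_def)
  have split: "M U = map_pmf ?h (pair_pmf (M (U \<inter> S)) (M (U - S)))"
    unfolding M_def using Pi_pmf_union[of "U \<inter> S" "U - S" False "\<lambda>_. bernoulli_pmf q"] fin
    by (simp add: Int_Diff_Un Int_Diff_disjoint)
  have prob: "measure_pmf.prob (random_hypergraph r n q) {E. P E} =
      measure_pmf.prob (pair_pmf (M (U \<inter> S)) (M (U - S))) {fg. P (R fg)}" for P
    unfolding random_hypergraph_def U_def[symmetric] M_def[symmetric] split
    by (simp add: vimage_def R_def)
  have X': "X (R (f, g)) = X {e \<in> U \<inter> S. f e}" for f g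
    by (subst X[symmetric], subst (2) X[symmetric], rule arg_cong[of _ _ X]) (auto simp: R_def)
  have Y': "Y (R (f, g)) = Y {e \<in> U - S. g e}" for f g
    by (subst Y[symmetric], subst (2) Y[symmetric], rule arg_cong[of _ _ Y]) (auto simp: R_def)
  have prod: "measure_pmf.prob (pair_pmf (M (U \<inter> S)) (M (U - S))) (A \<times> B) =
      measure_pmf.prob (M (U \<inter> S)) A * measure_pmf.prob (M (U - S)) B" for A B
  proof -
    \<comment> \<open>The product rule asks for countable sets; intersecting with the supports
      provides them.\<close>
    have "measure_pmf.prob (pair_pmf (M (U \<inter> S)) (M (U - S))) (A \<times> B) =
        measure_pmf.prob (pair_pmf (M (U \<inter> S)) (M (U - S)))
          ((A \<inter> set_pmf (M (U \<inter> S))) \<times> (B \<inter> set_pmf (M (U - S))))"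
      by (subst measure_Int_set_pmf[symmetric], rule arg_cong[of _ _ "measure_pmf.prob _"]) auto
    also have "\<dots> = measure_pmf.prob (M (U \<inter> S)) A * measure_pmf.prob (M (U - S)) B"
      by (subst measure_pmf_prob_product) (auto simp: measure_Int_set_pmf)
    finally show ?thesis .
  qed
  have "{fg. X (R fg) \<and> Y (R fg)} = {f. X {e \<in> U \<inter> S. f e}} \<times> {g. Y {e \<in> U - S. g e}}"
    by (auto simp: X' Y')
  moreover have "{fg. X (R fg)} = {f. X {e \<in> U \<inter> S. f e}} \<times> UNIV"
    by (auto simp: X' Y')
  moreover have "{fg. Y (R fg)} = UNIV \<times> {g. Y {e \<in> U - S. g e}}"
    by (auto simp: X' Y')
  ultimately show ?thesis
    unfolding prob by (simp only: prod) simp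
qed

text \<open>The event is a box: coordinates in \<open>F\<close> are fixed to \<open>b\<close>, the
  others are free. Leaving \<open>b\<close> open covers both \<open>F \<subseteq> E\<close> and
  \<open>F \<inter> E = {}\<close>.\<close>

lemma prob_random_hypergraph_Pi:
  assumes "F \<subseteq> r_subsets r n"
  shows "measure_pmf.prob (random_hypergraph r n q) {E. \<forall>e\<in>F. (e \<in> E) = b} =
    measure_pmf.prob (bernoulli_pmf q) {b} ^ card F"
proof -
  define U where "U = r_subsets r n"
  have fin: "finite U" and FU: "F \<subseteq> U" using assms by (auto simp: U_def)
  have "measure_pmf.prob (random_hypergraph r n q) {E. \<forall>e\<in>F. (e \<in> E) = b} =
      measure_pmf.prob (Pi_pmf U False (\<lambda>_. bernoulli_pmf q))
        (Pi U (\<lambda>e. if e \<in> F then {b} else UNIV))"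
    unfolding random_hypergraph_def U_def[symmetric] using FU
    by (auto simp: vimage_def Pi_def intro!: arg_cong[of _ _ "measure_pmf.prob _"])
  also have "\<dots> = (\<Prod>e\<in>U. if e \<in> F then measure_pmf.prob (bernoulli_pmf q) {b} else 1)"
    by (subst measure_Pi_pmf_Pi[OF fin]) (auto intro!: prod.cong)
  also have "\<dots> = measure_pmf.prob (bernoulli_pmf q) {b} ^ card F"
    using FU fin by (simp add: prod.If_cases Int_absorb1)
  finally show ?thesis .
qed

lemma prob_random_hypergraph_subset:
  assumes "F \<subseteq> r_subsets r n" "0 \<le> q" "q \<le> 1"
  shows "measure_pmf.prob (random_hypergraph r n q) {E. F \<subseteq> E} = q ^ card F"
  using prob_random_hypergraph_Pi[OF assms(1), of q True] assms
  by (simp add: subset_eq measure_pmf_single)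

lemma prob_random_hypergraph_disjoint:
  assumes "F \<subseteq> r_subsets r n" "0 \<le> q" "q \<le> 1"
  shows "measure_pmf.prob (random_hypergraph r n q) {E. F \<inter> E = {}} = (1 - q) ^ card F"
  using prob_random_hypergraph_Pi[OF assms(1), of q False] assms
  by (simp add: disjoint_iff Ball_def measure_pmf_single)

section \<open>Analytic bounds for the step-size distribution\<close>

text \<open>Summation by parts. If \<open>s j\<close> is the probability that a positive step
  exceeds \<open>j\<close>, the left side is the expectation of \<open>w\<close> at the step size
  capped at \<open>m\<close>.\<close>

lemma sum_diff_weighted:
  fixes s w :: "nat \<Rightarrow> real"
  shows "(\<Sum>j<m. (s j - s (Suc j)) * w (Suc j)) + s m * w m =
    s 0 * w 0 + (\<Sum>j<m. s j * (w (Suc j) - w j))"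
  by (induction m) (auto simp: algebra_simps)

text \<open>Since \<open>1 - q \<le> exp (- q)\<close>, it suffices that
  \<open>j * y - 1 \<le> q * (j choose d)\<close>. For \<open>j \<ge> d\<close> this follows from
  \<open>(j choose d) \<ge> (j / d) ^ d\<close> and \<open>y ^ d = q / d ^ d\<close>; for smaller
  \<open>j\<close> the left side is not positive. The factor \<open>exp 1\<close> pays for the
  \<open>- 1\<close>.\<close>

lemma one_minus_power_choose_le:
  fixes q :: real
  assumes d: "d \<ge> 1" and q: "0 < q" "q \<le> 1"
  defines "y \<equiv> q powr (1 / d) / d"
  shows "(1 - q) ^ (j choose d) \<le> exp 1 * exp (- (real j * y))"
proof -
  have yd: "y ^ d = q / real d ^ d"
    unfolding y_def using d q by (simp add: power_divide powr_realpow[symmetric] powr_powr)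
  have y0: "y > 0" using d q by (simp add: y_def)
  have "y \<le> 1 / d" using d q unfolding y_def by (intro divide_right_mono powr_le1) auto
  have key: "real j * y - 1 \<le> q * real (j choose d)"
  proof (cases "d \<le> j")
    case True
    have "real j * y - 1 \<le> (real j * y) ^ d"
    proof (cases "real j * y \<ge> 1")
      case True
      then show ?thesis using self_le_power[of "real j * y" d] d by auto
    next
      case False
      then show ?thesis using y0 by (smt (verit) of_nat_0_le_iff mult_nonneg_nonneg zero_le_power)
    qed
    also have "\<dots> = q * (real j / real d) ^ d"
      using yd by (simp add: power_mult_distrib power_divide)
    also have "\<dots> \<le> q * real (j choose d)"
      using q binomial_ge_n_over_k_pow_k[OF True, where 'a=real] by (intro mult_left_mono) auto
    finally show ?thesis .
  next
    case False
    have "real j * y \<le> real d * (1 / d)" using False \<open>y \<le> 1 / d\<close> y0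
      by (intro mult_mono) auto
    then have "real j * y \<le> 1" using d by simp
    then show ?thesis using q by (smt (verit) of_nat_0_le_iff mult_nonneg_nonneg)
  qed
  have "(1 - q) ^ (j choose d) \<le> exp (- q) ^ (j choose d)"
    using q exp_ge_add_one_self[of "-q"] by (intro power_mono) auto
  also have "\<dots> = exp (- (q * real (j choose d)))"
    by (simp add: exp_of_nat_mult[symmetric] mult.commute)
  also have "\<dots> \<le> exp (1 - real j * y)" using key by simp
  also have "\<dots> = exp 1 * exp (- (real j * y))" by (simp add: exp_add[symmetric])
  finally show ?thesis .
qed

section \<open>Paths built edge by edge from a start vertex\<close>

text \<open>Peeling off the first edge, with least vertex \<open>v\<close> and greatest vertex
  \<open>w\<close>, suits induction on the length and conditioning on the first step. Edge sizes are
  left to \<open>E\<close>.\<close>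

primrec path_from :: "nat set set \<Rightarrow> nat \<Rightarrow> nat \<Rightarrow> bool" where
  "path_from E 0 v = True"
| "path_from E (Suc l) v = (\<exists>e\<in>E. \<exists>w>v. v \<in> e \<and> w \<in> e \<and> e \<subseteq> {v..w} \<and> path_from E l w)"

lemma path_from_mono: "path_from E l v \<Longrightarrow> E \<subseteq> E' \<Longrightarrow> path_from E' l v"
proof (induction l arbitrary: v)
  case (Suc l)
  then obtain e w where "e \<in> E" "w > v" "v \<in> e" "w \<in> e" "e \<subseteq> {v..w}" "path_from E l w"
    by auto
  moreover have "e \<in> E'" "path_from E' l w"
    using Suc calculation by auto
  ultimately show ?case by auto
qed simp

lemma path_from_restrict:
  "path_from E l v \<Longrightarrow> path_from {e \<in> E. e \<subseteq> {v..}} l v"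
proof (induction l arbitrary: v)
  case (Suc l)
  then obtain e w where e: "e \<in> E" "w > v" "v \<in> e" "w \<in> e" "e \<subseteq> {v..w}" "path_from E l w"
    by auto
  have "path_from {e \<in> E. e \<subseteq> {v..}} l w"
    using e(2) by (intro path_from_mono[OF Suc.IH[OF e(6)]]) auto
  moreover have "e \<in> {e \<in> E. e \<subseteq> {v..}}" using e by auto
  ultimately show ?case unfolding path_from.simps using e by blast
qed simp

text \<open>An edge through \<open>v\<close> has a vertex left of \<open>w\<close>, so no path from
  \<open>w\<close> can use it. This separates the first step from the rest of the path in the
  independence argument.\<close>

lemma path_from_Diff:
  assumes "v < w"
  shows "path_from (E - {e. v \<in> e}) l w = path_from E l w"
proof
  assume "path_from E l w"
  moreover have "{e \<in> E. e \<subseteq> {w..}} \<subseteq> E - {e. v \<in> e}" using assms by auto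
  ultimately show "path_from (E - {e. v \<in> e}) l w"
    by (rule path_from_mono[OF path_from_restrict])
qed (rule path_from_mono, auto)

lemma ex_increasing_enumeration:
  fixes e :: "nat set"
  assumes "finite e"
  shows "\<exists>g. strict_mono_on {1..card e} g \<and> g ` {1..card e} = e"
proof -
  define g where "g i = sorted_list_of_set e ! (i - 1)" for i
  have "strict_mono_on {1..card e} g"
  proof (rule strict_mono_onI)
    fix i j assume "i \<in> {1..card e}" "j \<in> {1..card e}" "i < j"
    then show "g i < g j"
      unfolding g_def by (intro sorted_wrt_nth_less[OF strict_sorted_list_of_set]) auto
  qed
  moreover have "g ` {1..card e} = e"
  proof -
    have "{1..card e} = Suc ` {..<card e}" by (simp add: image_Suc_lessThan)
    then have "g ` {1..card e} = (!) (sorted_list_of_set e) ` {..<length (sorted_list_of_set e)}"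
      by (simp add: image_image g_def)
    also have "\<dots> = e"
      using set_conv_nth[of "sorted_list_of_set e"] assms by auto
    finally show ?thesis .
  qed
  ultimately show ?thesis by blast
qed

text \<open>The increasing enumeration \<open>g\<close> of the first edge is glued to the path
  \<open>h\<close> given by induction, with the indices of \<open>h\<close> moved up by
  \<open>d\<close>. Tracking the first vertex guarantees that the two pieces meet.\<close>

lemma ordered_loose_path_of_path_from:
  assumes E: "E \<subseteq> r_subsets r n" and r: "r \<ge> 2"
  shows "path_from E l v \<Longrightarrow> v \<in> {1..n} \<Longrightarrow> \<exists>f. ordered_loose_path r n E l f \<and> f 1 = v"
proof (induction l arbitrary: v)
  case 0
  then show ?case by (intro exI[of _ "\<lambda>_. v"]) (auto simp: ordered_loose_path_def strict_mono_on_def)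
next
  case (Suc l)
  define d where "d = r - 1"
  have d: "d \<ge> 1" "r = Suc d" using r by (auto simp: d_def)
  from Suc.prems(1) obtain e w where e: "e \<in> E" "w > v" "v \<in> e" "w \<in> e" "e \<subseteq> {v..w}"
    and pw: "path_from E l w" by auto
  have en: "e \<subseteq> {1..n}" "card e = Suc d" using e(1) E d by (auto simp: r_subsets_def)
  then have fin: "finite e" by (auto intro: finite_subset)
  obtain g where g: "strict_mono_on {1..Suc d} g" "g ` {1..Suc d} = e"
    using ex_increasing_enumeration[OF fin] en by auto
  obtain h where h: "ordered_loose_path r n E l h" "h 1 = w"
    using Suc.IH[OF pw] subsetD[OF en(1) e(4)] by auto
  have hm: "strict_mono_on {1..l * d + 1} h" and hn: "h ` {1..l * d + 1} \<subseteq> {1..n}"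
    and hE: "\<And>k. k \<in> {1..l} \<Longrightarrow> h ` {(k - 1) * d + 1..k * d + 1} \<in> E"
    using h(1) d by (auto simp: ordered_loose_path_def)
  have gm: "g i \<le> g j" if "1 \<le> i" "i \<le> j" "j \<le> Suc d" for i j
    using that strict_mono_onD[OF g(1), of i j] by (cases "i = j") auto
  have g1: "g 1 = v"
  proof -
    obtain i where "i \<in> {1..Suc d}" "g i = v" using g(2) e(3) by auto
    then have "g 1 \<le> v" using gm[of 1 i] by auto
    moreover have "g 1 \<in> e" using g(2) by auto
    ultimately show ?thesis using e(5) by force
  qed
  have gd: "g (Suc d) = w"
  proof -
    obtain i where "i \<in> {1..Suc d}" "g i = w" using g(2) e(4) by auto
    then have "w \<le> g (Suc d)" using gm[of i "Suc d"] by auto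
    moreover have "g (Suc d) \<in> e" using g(2) by auto
    ultimately show ?thesis using e(5) by force
  qed
  \<comment> \<open>The index \<open>Suc d\<close> belongs to both pieces, and both take the value
    \<open>w\<close> there.\<close>
  define f where "f i = (if i \<le> d then g i else h (i - d))" for i
  have fg: "f i = g i" if "i \<le> Suc d" for i
    using that h(2) gd by (cases "i = Suc d") (auto simp: f_def)
  have fh: "f (i + d) = h i" if "i \<ge> 1" for i using that by (auto simp: f_def)
  have "strict_mono_on {1..Suc l * d + 1} f"
  proof (rule strict_mono_onI)
    fix i j assume ij: "i \<in> {1..Suc l * d + 1}" "j \<in> {1..Suc l * d + 1}" "i < j"
    consider "j \<le> Suc d" | "i \<ge> Suc d" | "i < Suc d" "Suc d < j" by linarith
    then show "f i < f j"
    proof cases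
      case 1 then show ?thesis using ij fg strict_mono_onD[OF g(1), of i j] by auto
    next
      case 2
      then show ?thesis using ij strict_mono_onD[OF hm, of "i - d" "j - d"] by (auto simp: f_def)
    next
      case 3
      have "f i < w" using 3 ij fg gd strict_mono_onD[OF g(1), of i "Suc d"] by auto
      also have "w < f j" using 3 ij h(2) strict_mono_onD[OF hm, of 1 "j - d"] by (auto simp: f_def)
      finally show ?thesis .
    qed
  qed
  moreover have "f ` {1..Suc l * d + 1} \<subseteq> {1..n}"
  proof
    fix x assume "x \<in> f ` {1..Suc l * d + 1}"
    then obtain i where i: "x = f i" "i \<in> {1..Suc l * d + 1}" by auto
    show "x \<in> {1..n}"
    proof (cases "i \<le> d")
      case True
      then have "f i \<in> g ` {1..Suc d}" using i by (auto simp: f_def)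
      then show ?thesis using g(2) en i by auto
    next
      case False
      then have "f i \<in> h ` {1..l * d + 1}" using i by (auto simp: f_def intro!: imageI)
      then show ?thesis using hn i by auto
    qed
  qed
  moreover have "f ` {(k - 1) * d + 1..k * d + 1} \<in> E" if k: "k \<in> {1..Suc l}" for k
  proof (cases "k = 1")
    case True
    have "f ` {1..Suc d} = g ` {1..Suc d}" using fg by (intro image_cong) auto
    then show ?thesis using True g(2) e(1) by simp
  next
    case False
    define k' where "k' = k - 1"
    have k': "k' \<in> {1..l}" "k = Suc k'" using False k by (auto simp: k'_def)
    \<comment> \<open>As \<open>k'\<close> is positive, \<open>k' - 1\<close> is not truncated, and
      the block of \<open>Suc k'\<close> is the block of \<open>k'\<close> shifted by
      \<open>d\<close>.\<close>
    then obtain k'' where k'': "k' = Suc k''" by (cases k') auto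
    have "{k' * d + 1..Suc k' * d + 1} = (\<lambda>i. i + d) ` {(k' - 1) * d + 1..k' * d + 1}"
      unfolding image_add_atLeastAtMost' by (simp add: k'' algebra_simps)
    from arg_cong[OF this, of "(`) f"]
    have "f ` {k' * d + 1..Suc k' * d + 1} = (\<lambda>i. f (i + d)) ` {(k' - 1) * d + 1..k' * d + 1}"
      by (simp only: image_image)
    also have "\<dots> = h ` {(k' - 1) * d + 1..k' * d + 1}"
      by (intro image_cong fh) auto
    finally have "f ` {k' * d + 1..Suc k' * d + 1} = h ` {(k' - 1) * d + 1..k' * d + 1}" .
    then show ?thesis using hE[OF k'(1)] k'(2) by simp
  qed
  moreover have "f 1 = v" using fg[of 1] g1 by simp
  ultimately show ?case unfolding ordered_loose_path_def d_def[symmetric] by blast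
qed

section \<open>The greedy step and the failure probability of the greedy path\<close>

text \<open>These are the candidate edges for a step of size at most \<open>j\<close> from
  \<open>v\<close>: the greedy step exceeds \<open>j\<close> exactly when none of them is
  present.\<close>

definition forward_star :: "nat \<Rightarrow> nat \<Rightarrow> nat \<Rightarrow> nat set set" where
  "forward_star r v j = insert v ` {T. T \<subseteq> {v + 1..v + j} \<and> card T = r - 1}"

lemma card_forward_star: "card (forward_star r v j) = j choose (r - 1)"
proof -
  have "inj_on (insert v) {T. T \<subseteq> {v + 1..v + j} \<and> card T = r - 1}"
  proof (rule inj_onI)
    fix S T assume "S \<in> {T. T \<subseteq> {v + 1..v + j} \<and> card T = r - 1}"
      and "T \<in> {T. T \<subseteq> {v + 1..v + j} \<and> card T = r - 1}" and eq: "insert v S = insert v T"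
    then have "v \<notin> S" "v \<notin> T" by auto
    then show "S = T" using eq by (simp add: insert_ident)
  qed
  then show ?thesis
    using n_subsets[of "{v + 1..v + j}" "r - 1"] by (simp add: forward_star_def card_image)
qed

lemma forward_star_subset:
  assumes "r \<ge> 1" "v \<ge> 1" "v + j \<le> n"
  shows "forward_star r v j \<subseteq> r_subsets r n"
proof
  fix e assume "e \<in> forward_star r v j"
  then obtain T where T: "e = insert v T" "T \<subseteq> {v + 1..v + j}" "card T = r - 1"
    by (auto simp: forward_star_def)
  have "finite T" "v \<notin> T" using T(2) by (auto intro: finite_subset)
  then have "card e = r" using T assms by simp
  moreover have "e \<subseteq> {1..n}" using T assms by fastforce
  ultimately show "e \<in> r_subsets r n" by (simp add: r_subsets_def)
qed

lemma forward_star_mono: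
  assumes "i \<le> j"
  shows "forward_star r v i \<subseteq> forward_star r v j"
proof -
  have "{v + 1..v + i} \<subseteq> {v + 1..v + j}" using assms by auto
  then show ?thesis unfolding forward_star_def by (intro image_mono) blast
qed

lemma forward_star_0: "r \<ge> 2 \<Longrightarrow> forward_star r v 0 = {}"
  by (auto simp: forward_star_def)

text \<open>Without \<open>v + Suc j\<close>, the other vertices of \<open>e\<close> would already
  fit within radius \<open>j\<close>. So an edge that is new at radius \<open>Suc j\<close> makes a
  step of exactly this size.\<close>

lemma forward_star_Suc:
  assumes "e \<in> forward_star r v (Suc j)" "e \<notin> forward_star r v j"
  shows "v \<in> e \<and> v + Suc j \<in> e \<and> e \<subseteq> {v..v + Suc j}"
proof -
  obtain T where T: "e = insert v T" "T \<subseteq> {v + 1..v + Suc j}" "card T = r - 1"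
    using assms(1) by (auto simp: forward_star_def)
  have "v + Suc j \<in> T"
  proof (rule ccontr)
    assume "v + Suc j \<notin> T"
    then have "T \<subseteq> {v + 1..v + j}"
      using T(2) by (auto simp: subset_iff le_Suc_eq)
    then show False using assms(2) T by (auto simp: forward_star_def)
  qed
  then show ?thesis using T by force
qed

text \<open>At the smallest radius where the star meets \<open>E\<close>, a new edge ends at
  \<open>v + Suc j\<close>, and a path of length \<open>l\<close> from there would give one of
  length \<open>Suc l\<close> from \<open>v\<close>. Induction on \<open>m\<close> finds this
  radius, starting from the empty star at \<open>0\<close>.\<close>

lemma not_path_from_Suc:
  assumes "r \<ge> 2" "\<not> path_from E (Suc l) v"
  shows "forward_star r v m \<inter> E = {} \<or>
    (\<exists>j<m. forward_star r v j \<inter> E = {} \<and> forward_star r v (Suc j) \<inter> E \<noteq> {} \<and>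
      \<not> path_from E l (v + Suc j))"
proof (induction m)
  case 0
  then show ?case using assms by (simp add: forward_star_0)
next
  case (Suc m)
  show ?case
  proof (cases "forward_star r v m \<inter> E = {} \<and> forward_star r v (Suc m) \<inter> E \<noteq> {}")
    case True
    then obtain e where e: "e \<in> forward_star r v (Suc m)" "e \<in> E" "e \<notin> forward_star r v m" by auto
    then have "\<not> path_from E l (v + Suc m)"
      using assms(2) forward_star_Suc[of e r v m] by force
    then show ?thesis using True by blast
  next
    case False
    then show ?thesis using Suc.IH less_SucI by blast
  qed
qed

text \<open>Induction on \<open>l\<close>, conditioning on the first step of the greedy path: it goes to \<open>v + j\<close> with
  probability \<open>s (j - 1) - s j\<close>, and the edges met after that do not contain \<open>v\<close>. The rate \<open>z\<close> is
  chosen such that \<open>exp (z * J)\<close>, for the step size \<open>J\<close>, has expectation at most \<open>1 + exp 2\<close>,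
  uniformly in \<open>q\<close>.\<close>

lemma prob_not_path_from_le:
  fixes q :: real
  assumes r: "r \<ge> 2" and q: "0 < q" "q \<le> 1"
  defines "z \<equiv> q powr (1 / real (r - 1)) / (2 * real (r - 1))"
  shows "1 \<le> v \<Longrightarrow> v + m = n \<Longrightarrow>
    measure_pmf.prob (random_hypergraph r n q) {E. \<not> path_from E l v} \<le>
      (1 + exp 2) ^ l * exp (- (real m * z))"
proof (induction l arbitrary: v m)
  case 0
  then show ?case by simp
next
  case (Suc l)
  let ?P = "measure_pmf.prob (random_hypergraph r n q)"
  define A :: real where "A = 1 + exp 2"
  \<comment> \<open>For \<open>j \<le> m\<close>, \<open>s j\<close> is the probability that the
    step exceeds \<open>j\<close>; \<open>w\<close> is the exponential weight, and
    \<open>X j\<close> is the event that the step is exactly \<open>Suc j\<close>.\<close>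
  define s where "s j = (1 - q) ^ (j choose (r - 1))" for j
  define w where "w j = exp (real j * z)" for j
  define X where "X j = {E. forward_star r v j \<inter> E = {} \<and> forward_star r v (Suc j) \<inter> E \<noteq> {}}" for j
  have A: "A \<ge> 1" by (simp add: A_def)
  have z: "0 \<le> z" "z \<le> 1"
  proof -
    have "q powr (1 / real (r - 1)) \<le> 1" using q by (intro powr_le1) auto
    then show "z \<le> 1" using r by (simp add: z_def)
  qed (simp add: z_def)
  \<comment> \<open>The tail decays at rate \<open>2 * z\<close>, twice the rate at which
    \<open>w\<close> grows; the surplus makes the weighted sum below bounded.\<close>
  have s_le: "s j \<le> exp 1 * exp (- (2 * (real j * z)))" for j
  proof -
    have "2 * (real j * z) = real j * (q powr (1 / real (r - 1)) / real (r - 1))"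
      by (simp add: z_def)
    then show ?thesis
      using one_minus_power_choose_le[of "r - 1" q j] r q unfolding s_def by simp
  qed
  have Ps: "?P {E. forward_star r v j \<inter> E = {}} = s j" if "j \<le> m" for j
  proof -
    have "forward_star r v j \<subseteq> r_subsets r n"
      using that Suc.prems r by (intro forward_star_subset) auto
    then show ?thesis
      using q by (simp add: prob_random_hypergraph_disjoint card_forward_star s_def)
  qed
  have PX: "?P (X j) = s j - s (Suc j)" if "j < m" for j
  proof -
    have "X j = {E. forward_star r v j \<inter> E = {}} - {E. forward_star r v (Suc j) \<inter> E = {}}"
      by (auto simp: X_def)
    also have "?P \<dots> = s j - s (Suc j)"
      using that Ps[of j] Ps[of "Suc j"] forward_star_mono[of j "Suc j" r v]
      by (subst measure_pmf.finite_measure_Diff) auto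
    finally show ?thesis .
  qed
  have PXN: "?P (X j \<inter> {E. \<not> path_from E l (v + Suc j)}) \<le>
      (s j - s (Suc j)) * (A ^ l * (exp (- (real m * z)) * w (Suc j)))" if "j < m" for j
  proof -
    \<comment> \<open>\<open>X j\<close> looks only at edges through \<open>v\<close>, the
      continuation only at edges avoiding \<open>v\<close>.\<close>
    have "?P (X j \<inter> {E. \<not> path_from E l (v + Suc j)}) =
        ?P (X j) * ?P {E. \<not> path_from E l (v + Suc j)}"
      using prob_random_hypergraph_indep[where S = "{e. v \<in> e}" and X = "\<lambda>E. E \<in> X j"
          and Y = "\<lambda>E. \<not> path_from E l (v + Suc j)" and r = r and n = n and q = q]
      by (simp add: X_def path_from_Diff Int_def) (auto simp: forward_star_def)
    also have "?P {E. \<not> path_from E l (v + Suc j)} \<le> A ^ l * exp (- (real (m - Suc j) * z))"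
      unfolding A_def using that Suc.prems by (intro Suc.IH) auto
    also have "exp (- (real (m - Suc j) * z)) = exp (- (real m * z)) * w (Suc j)"
      using that by (simp add: w_def exp_add[symmetric] of_nat_diff algebra_simps)
    finally show ?thesis
      using PX[OF that] measure_nonneg[of "measure_pmf (random_hypergraph r n q)" "X j"]
      by (simp add: mult_left_mono)
  qed
  have "?P {E. \<not> path_from E (Suc l) v} \<le>
      ?P ((\<Union>j<m. X j \<inter> {E. \<not> path_from E l (v + Suc j)}) \<union> {E. forward_star r v m \<inter> E = {}})"
    using not_path_from_Suc[OF r, of _ l v m]
    by (intro measure_pmf.finite_measure_mono) (auto simp: X_def simp del: path_from.simps)
  also have "\<dots> \<le> ?P (\<Union>j<m. X j \<inter> {E. \<not> path_from E l (v + Suc j)}) +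
      ?P {E. forward_star r v m \<inter> E = {}}"
    by (intro measure_Un_le) auto
  also have "\<dots> \<le> (\<Sum>j<m. ?P (X j \<inter> {E. \<not> path_from E l (v + Suc j)})) + s m"
    using Ps[of m] by (intro add_mono measure_pmf.finite_measure_subadditive_finite) auto
  also have "\<dots> \<le> (\<Sum>j<m. (s j - s (Suc j)) * (A ^ l * (exp (- (real m * z)) * w (Suc j)))) +
      A ^ l * (exp (- (real m * z)) * (s m * w m))"
  proof (intro add_mono sum_mono PXN)
    \<comment> \<open>Inserting this factor \<open>1\<close> puts the event of no step up to
      \<open>m\<close> into the form of the boundary term of the summation by parts.\<close>
    have "exp (- (real m * z)) * w m = 1" by (simp add: w_def exp_minus)
    then have eq: "exp (- (real m * z)) * (s m * w m) = s m"
      by (metis mult.left_commute mult.right_neutral)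
    have "1 * s m \<le> A ^ l * s m"
      using A q by (intro mult_right_mono) (auto simp: s_def)
    then show "s m \<le> A ^ l * (exp (- (real m * z)) * (s m * w m))"
      unfolding eq by simp
  qed auto
  also have "\<dots> = A ^ l * exp (- (real m * z)) *
      ((\<Sum>j<m. (s j - s (Suc j)) * w (Suc j)) + s m * w m)"
    by (simp add: sum_distrib_left sum_distrib_right algebra_simps)
  \<comment> \<open>After summation by parts, the tail bound turns the sum into \<open>exp 1\<close>
    times a telescoping one, of total at most \<open>exp 1 * exp z \<le> exp 2\<close>.\<close>
  also have "(\<Sum>j<m. (s j - s (Suc j)) * w (Suc j)) + s m * w m \<le> A"
  proof -
    have "(\<Sum>j<m. s j * (w (Suc j) - w j)) \<le>
        (\<Sum>j<m. exp 1 * (exp (z - real j * z) - exp (z - real (Suc j) * z)))"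
    proof (intro sum_mono)
      fix j
      have "w (Suc j) - w j = w j * (exp z - 1)"
        by (simp add: w_def exp_add[symmetric] algebra_simps)
      moreover have "s j * (w j * (exp z - 1)) \<le>
          (exp 1 * exp (- (2 * (real j * z)))) * (w j * (exp z - 1))"
        using z by (intro mult_right_mono s_le) (auto simp: w_def)
      moreover have "exp (- (2 * (real j * z))) * (w j * (exp z - 1)) =
          exp (z - real j * z) - exp (z - real (Suc j) * z)"
        by (simp add: w_def exp_add[symmetric] algebra_simps)
      ultimately show "s j * (w (Suc j) - w j) \<le>
          exp 1 * (exp (z - real j * z) - exp (z - real (Suc j) * z))"
        by (simp add: mult.assoc)
    qed
    also have "\<dots> = exp 1 * (exp z - exp (z - real m * z))"
      using sum_lessThan_telescope'[of "\<lambda>j. exp (z - real j * z)" m]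
      by (simp add: sum_distrib_left[symmetric] del: of_nat_Suc)
    also have "\<dots> \<le> exp 1 * exp 1"
    proof (intro mult_left_mono)
      have "exp z \<le> exp 1" using z by simp
      then show "exp z - exp (z - real m * z) \<le> exp 1" by (smt (verit) exp_gt_zero)
    qed simp
    also have "\<dots> = exp 2" by (simp add: exp_add[symmetric])
    moreover have "s 0 * w 0 = 1" using r by (simp add: s_def w_def binomial_eq_0)
    ultimately show ?thesis unfolding sum_diff_weighted A_def by simp
  qed
  finally show ?case using A by (simp add: A_def[symmetric] mult_ac)
qed

section \<open>Maximum length and the first-moment bound\<close>

lemma set_pmf_random_hypergraph: "set_pmf (random_hypergraph r n q) \<subseteq> Pow (r_subsets r n)"
  by (auto simp: random_hypergraph_def)

lemma ordered_loose_path_mono: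
  assumes "ordered_loose_path r n E l v" "l' \<le> l"
  shows "ordered_loose_path r n E l' v"
proof -
  have "l' * (r - 1) \<le> l * (r - 1)" using assms(2) by simp
  then have sub: "{1..l' * (r - 1) + 1} \<subseteq> {1..l * (r - 1) + 1}" by auto
  have "strict_mono_on {1..l' * (r - 1) + 1} v"
    using assms(1) sub unfolding ordered_loose_path_def strict_mono_on_def by blast
  moreover have "v ` {1..l' * (r - 1) + 1} \<subseteq> {1..n}"
    using assms(1) image_mono[OF sub, of v] unfolding ordered_loose_path_def by blast
  ultimately show ?thesis
    using assms unfolding ordered_loose_path_def by simp
qed

lemma ordered_loose_path_length_le:
  assumes "ordered_loose_path r n E l v" "r \<ge> 2"
  shows "l \<le> n"
proof -
  let ?I = "{1..l * (r - 1) + 1}"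
  have "card ?I = card (v ` ?I)"
    using assms(1) by (simp add: ordered_loose_path_def card_image strict_mono_on_imp_inj_on)
  also have "\<dots> \<le> card {1..n}"
    using assms(1) by (intro card_mono) (auto simp: ordered_loose_path_def)
  finally have "l * (r - 1) + 1 \<le> n" by simp
  moreover have "1 \<le> r - 1" using assms(2) by linarith
  then have "l \<le> l * (r - 1)" using mult_le_mono2[of 1 "r - 1" l] by linarith
  ultimately show ?thesis by linarith
qed

text \<open>The attained lengths are bounded by \<open>n\<close>, contain \<open>0\<close>, and are
  closed downwards by truncating a path.\<close>

lemma le_max_path_length_iff:
  assumes "r \<ge> 2" "n \<ge> 1"
  shows "l \<le> max_path_length r n E \<longleftrightarrow> (\<exists>v. ordered_loose_path r n E l v)"
proof -
  let ?L = "{l. \<exists>v. ordered_loose_path r n E l v}"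
  have fin: "finite ?L"
    by (rule finite_subset[of _ "{..n}"]) (auto dest: ordered_loose_path_length_le[OF _ assms(1)])
  have "ordered_loose_path r n E 0 (\<lambda>_. 1)"
    using assms by (simp add: ordered_loose_path_def strict_mono_on_def)
  then have "Max ?L \<in> ?L" using fin by (intro Max_in) auto
  then obtain v where v: "ordered_loose_path r n E (Max ?L) v" by blast
  have "l \<le> Max ?L \<longleftrightarrow> (\<exists>v. ordered_loose_path r n E l v)"
  proof
    assume "l \<le> Max ?L"
    then show "\<exists>v. ordered_loose_path r n E l v" using ordered_loose_path_mono[OF v] by blast
  next
    assume "\<exists>v. ordered_loose_path r n E l v"
    then show "l \<le> Max ?L" using fin by (intro Max_ge) simp_all
  qed
  then show ?thesis by (simp only: max_path_length_def)
qed

text \<open>Strictly sorted lists with equal sets coincide. Hence an ordered path is determined by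
  its vertex set, and paths can be counted by such sets.\<close>

lemma increasing_enumeration_unique:
  fixes f g :: "nat \<Rightarrow> nat"
  assumes f: "strict_mono_on {1..m} f" and g: "strict_mono_on {1..m} g"
    and eq: "f ` {1..m} = g ` {1..m}" and i: "i \<in> {1..m}"
  shows "f i = g i"
proof -
  have sorted: "sorted_wrt (<) (map h [1..<Suc m])" if "strict_mono_on {1..m} h" for h :: "nat \<Rightarrow> nat"
    unfolding sorted_wrt_map
    by (rule sorted_wrt_mono_rel[OF _ sorted_wrt_upt]) (auto intro: strict_mono_onD[OF that])
  have set: "set [1..<Suc m] = {1..m}" by auto
  then have "map f [1..<Suc m] = map g [1..<Suc m]"
    using eq set by (intro strict_sorted_equal sorted f g) (simp only: set_map)
  then have "\<forall>j\<in>{1..m}. f j = g j" by (simp only: map_eq_conv set)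
  then show ?thesis using i by blast
qed

text \<open>Union bound over the vertex sets \<open>V\<close> of size \<open>m\<close>: each admits
  only one increasing enumeration \<open>g\<close>, which prescribes \<open>l\<close> distinct
  edges.\<close>

lemma prob_ordered_loose_path_le:
  assumes r: "r \<ge> 2" and q: "0 \<le> q" "q \<le> 1"
  shows "measure_pmf.prob (random_hypergraph r n q) {E. \<exists>v. ordered_loose_path r n E l v} \<le>
    real (n choose (l * (r - 1) + 1)) * q ^ l"
proof -
  let ?P = "measure_pmf.prob (random_hypergraph r n q)"
  define d where "d = r - 1"
  define m where "m = l * d + 1"
  define \<V> where "\<V> = {V. V \<subseteq> {1..n} \<and> card V = m}"
  define X where "X V = {E. \<exists>v. ordered_loose_path r n E l v \<and> v ` {1..m} = V}" for V
  have d: "d \<ge> 1" "r = Suc d" using r by (auto simp: d_def)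
  have fin: "finite \<V>"
    by (rule finite_subset[of _ "Pow {1..n}"]) (auto simp: \<V>_def)
  have X_le: "?P (X V) \<le> q ^ l" if V: "V \<in> \<V>" for V
  proof -
    have Vn: "V \<subseteq> {1..n}" "card V = m" using V by (auto simp: \<V>_def)
    then obtain g where g: "strict_mono_on {1..m} g" "g ` {1..m} = V"
      using ex_increasing_enumeration[of V] finite_subset[of V "{1..n}"] by auto
    have inj: "inj_on g {1..m}" using g(1) by (rule strict_mono_on_imp_inj_on)
    define J where "J k = {(k - 1) * d + 1..k * d + 1}" for k
    have J: "J k \<subseteq> {1..m}" if "k \<in> {1..l}" for k
    proof -
      have "k * d \<le> l * d" using that by simp
      then show ?thesis by (auto simp: J_def m_def)
    qed
    have card_J: "card (J k) = r" if "k \<in> {1..l}" for k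
    proof -
      obtain k' where "k = Suc k'" using \<open>k \<in> {1..l}\<close> by (cases k) auto
      then show ?thesis using d by (simp add: J_def)
    qed
    have "inj_on (\<lambda>k. g ` J k) {1..l}"
    proof (rule inj_onI)
      fix i k assume ik: "i \<in> {1..l}" "k \<in> {1..l}" "g ` J i = g ` J k"
      then have "J i = J k" using inj_on_image_eq_iff[OF inj] J by blast
      \<comment> \<open>The greatest index of a block determines the block number, so the exponent
        is exactly \<open>l\<close>.\<close>
      moreover have "Max (J j) = j * d + 1" for j
        unfolding J_def by (intro Max_eqI) (auto intro: mult_le_mono1)
      ultimately have "i * d = k * d" by (metis add_right_cancel)
      then show "i = k" using d by simp
    qed
    then have card: "card ((\<lambda>k. g ` J k) ` {1..l}) = l" by (simp add: card_image)
    have "(\<lambda>k. g ` J k) ` {1..l} \<subseteq> r_subsets r n"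
    proof
      fix e assume "e \<in> (\<lambda>k. g ` J k) ` {1..l}"
      then obtain k where k: "k \<in> {1..l}" "e = g ` J k" by auto
      have "card e = r"
        using card_image[OF inj_on_subset[OF inj J[OF k(1)]]] k card_J by simp
      moreover have "e \<subseteq> {1..n}" using image_mono[OF J[OF k(1)], of g] g(2) Vn k by auto
      ultimately show "e \<in> r_subsets r n" by (simp add: r_subsets_def)
    qed
    then have "?P {E. (\<lambda>k. g ` J k) ` {1..l} \<subseteq> E} = q ^ l"
      using q card by (simp only: prob_random_hypergraph_subset)
    moreover have "X V \<subseteq> {E. (\<lambda>k. g ` J k) ` {1..l} \<subseteq> E}"
    proof safe
      fix E k assume "E \<in> X V" and k: "k \<in> {1..l}"
      then obtain v where v: "ordered_loose_path r n E l v" "v ` {1..m} = V" by (auto simp: X_def)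
      have "strict_mono_on {1..m} v" using v(1) by (simp add: ordered_loose_path_def m_def d_def)
      then have "v i = g i" if "i \<in> {1..m}" for i
        using increasing_enumeration_unique[of m v g i] g v(2) that by simp
      then have "g ` J k = v ` J k" using J[OF k] by (intro image_cong) auto
      also have "\<dots> \<in> E" using v(1) k by (auto simp: ordered_loose_path_def J_def d_def)
      finally show "g ` J k \<in> E" .
    qed
    ultimately show ?thesis
      by (metis measure_pmf.finite_measure_mono sets_measure_pmf UNIV_I Pow_UNIV)
  qed
  have "{E. \<exists>v. ordered_loose_path r n E l v} \<subseteq> (\<Union>V\<in>\<V>. X V)"
  proof safe
    fix E v assume v: "ordered_loose_path r n E l v"
    then have "card (v ` {1..m}) = m"
      using card_image[OF strict_mono_on_imp_inj_on, of "{1..m}" v]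
      by (simp add: ordered_loose_path_def m_def d_def)
    then have "v ` {1..m} \<in> \<V>"
      using v by (simp add: \<V>_def ordered_loose_path_def m_def d_def)
    then show "E \<in> (\<Union>V\<in>\<V>. X V)" using v by (auto simp: X_def)
  qed
  then have "?P {E. \<exists>v. ordered_loose_path r n E l v} \<le> ?P (\<Union>V\<in>\<V>. X V)"
    by (intro measure_pmf.finite_measure_mono) auto
  also have "\<dots> \<le> (\<Sum>V\<in>\<V>. ?P (X V))"
    using fin by (intro measure_pmf.finite_measure_subadditive_finite) auto
  also have "\<dots> \<le> (\<Sum>V\<in>\<V>. q ^ l)" by (intro sum_mono X_le)
  also have "\<dots> = real (n choose m) * q ^ l"
    using n_subsets[of "{1..n}" m] by (simp add: \<V>_def)
  finally show ?thesis by (simp add: m_def d_def)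
qed

section \<open>Binomial estimates\<close>

lemma power_le_exp_mult_fact:
  fixes x :: real
  assumes "x \<ge> 0"
  shows "x ^ m \<le> exp x * fact m"
proof -
  have "(\<Sum>k\<in>{m}. x ^ k / fact k) \<le> (\<Sum>k. x ^ k / fact k)"
    using assms summable_exp[of x] by (intro sum_le_suminf) (auto simp: field_simps)
  then have "x ^ m / fact m \<le> exp x" by (simp add: exp_def scaleR_conv_of_real field_simps)
  then show ?thesis by (simp add: field_simps)
qed

text \<open>Combines \<open>m ^ m \<le> exp m * fact m\<close>, a single term of the exponential
  series, with \<open>(n choose m) * fact m \<le> n ^ m\<close>.\<close>

lemma binomial_le_exp_power:
  assumes "m \<ge> 1"
  shows "real (n choose m) \<le> (exp 1 * real n / real m) ^ m"
proof -
  have "real (n choose m) * real m ^ m \<le> real (n choose m) * (exp (real m) * fact m)"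
    by (intro mult_left_mono power_le_exp_mult_fact) auto
  also have "\<dots> = exp (real m) * real ((n choose m) * fact m)" by simp
  also have "\<dots> \<le> exp (real m) * real (n ^ m)"
    by (intro mult_left_mono) (simp_all only: of_nat_le_iff binomial_fact_pow exp_ge_zero)
  also have "\<dots> = (exp 1 * real n) ^ m"
    by (simp add: power_mult_distrib exp_of_nat_mult[symmetric])
  finally show ?thesis using assms by (simp add: power_divide field_simps)
qed

lemma binomial_mult_power_le:
  fixes q :: real
  assumes d: "d \<ge> 1" and q: "0 < q" and l: "exp 2 * (real n * q powr (1 / real d)) \<le> real l"
  shows "real (n choose (l * d + 1)) * q ^ l \<le> exp (- real l) / q powr (1 / real d)"
proof -
  define m where "m = l * d + 1"
  define y where "y = q powr (1 / real d)"
  have y: "y > 0" using q by (simp add: y_def)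
  have "l \<le> l * d" using d by simp
  then have lm: "l \<le> m" unfolding m_def by linarith
  have "y ^ d = q" unfolding y_def using d q by (simp add: powr_realpow[symmetric] powr_powr)
  \<comment> \<open>A path has one vertex more than the exponent \<open>l * d\<close>, which costs
    the factor \<open>1 / y\<close>.\<close>
  then have ql: "q ^ l = y ^ m / y" using y by (simp add: m_def power_mult mult.commute)
  have "real (n choose m) * q ^ l \<le> (exp 1 * real n / real m) ^ m * (y ^ m / y)"
    unfolding ql using y by (intro mult_right_mono binomial_le_exp_power) (auto simp: m_def)
  also have "\<dots> = (exp 1 * (real n * y) / real m) ^ m / y"
    by (simp add: power_mult_distrib power_divide)
  also have "\<dots> \<le> exp (-1) ^ m / y"
  proof (intro divide_right_mono power_mono)
    \<comment> \<open>One factor \<open>exp 1\<close> comes from the binomial bound; the other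
      leaves a base of at most \<open>exp (-1)\<close>.\<close>
    have "exp 1 * (exp 1 * (real n * y)) \<le> real m"
      using l lm by (simp add: y_def mult.assoc[symmetric] exp_add[symmetric])
    moreover have "m > 0" by (simp add: m_def)
    then have "real m > 0" by simp
    ultimately show "exp 1 * (real n * y) / real m \<le> exp (-1)"
      by (simp add: exp_minus field_simps)
  qed (use y in auto)
  also have "\<dots> \<le> exp (- real l) / y"
    using lm y by (simp add: exp_of_nat_mult[symmetric] divide_right_mono)
  finally show ?thesis by (simp add: m_def y_def)
qed

section \<open>Tail bounds for the maximum length at fixed \<open>n\<close>\<close>

lemma prob_max_path_length_gt_le:
  fixes q C :: real
  assumes r: "r \<ge> 2" and n: "n \<ge> 1" and q: "0 < q" "q \<le> 1" and C: "C \<ge> exp 2"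
  defines "x \<equiv> real n * q powr (1 / (real r - 1))"
  shows "measure_pmf.prob (random_hypergraph r n q) {E. real (max_path_length r n E) > C * x} \<le>
    exp (- C * x) * real n / x"
proof -
  define l where "l = nat \<lceil>C * x\<rceil>"
  have x: "x > 0" using n q by (simp add: x_def)
  have d: "real (r - 1) = real r - 1" using r by (simp add: of_nat_diff)
  have "C * x \<le> real l" by (simp add: l_def real_nat_ceiling_ge)
  have "{E. real (max_path_length r n E) > C * x} \<subseteq> {E. \<exists>v. ordered_loose_path r n E l v}"
    unfolding le_max_path_length_iff[OF r n, symmetric] by (auto simp: l_def ceiling_le_iff)
  then have "measure_pmf.prob (random_hypergraph r n q) {E. real (max_path_length r n E) > C * x} \<le>
      measure_pmf.prob (random_hypergraph r n q) {E. \<exists>v. ordered_loose_path r n E l v}"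
    by (intro measure_pmf.finite_measure_mono) auto
  also have "\<dots> \<le> real (n choose (l * (r - 1) + 1)) * q ^ l"
    using r q by (intro prob_ordered_loose_path_le) auto
  also have "\<dots> \<le> exp (- real l) / q powr (1 / real (r - 1))"
  proof (rule binomial_mult_power_le)
    have "exp 2 * x \<le> C * x" using C x by simp
    then show "exp 2 * (real n * q powr (1 / real (r - 1))) \<le> real l"
      using \<open>C * x \<le> real l\<close> unfolding d x_def by linarith
  qed (use r q in auto)
  also have "\<dots> \<le> exp (- C * x) / q powr (1 / real (r - 1))"
    using \<open>C * x \<le> real l\<close> by (intro divide_right_mono) auto
  also have "\<dots> = exp (- C * x) * real n / x"
    using n unfolding x_def d by simp
  finally show ?thesis .
qed

lemma prob_max_path_length_less_le:
  fixes q :: real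
  assumes r: "r \<ge> 2" and n: "n \<ge> 1" and q: "0 < q" "q \<le> 1"
  defines "x \<equiv> real n * q powr (1 / (real r - 1))"
  shows "measure_pmf.prob (random_hypergraph r n q)
      {E. real (max_path_length r n E) < x / (4 * (real r - 1) * ln (1 + exp 2))} \<le>
    (1 + exp 2) * exp 1 * exp (- x / (4 * (real r - 1)))"
proof -
  let ?P = "measure_pmf.prob (random_hypergraph r n q)"
  define A :: real where "A = 1 + exp 2"
  define d where "d = real r - 1"
  define y where "y = q powr (1 / d)"
  \<comment> \<open>With this choice \<open>A ^ l\<close> costs at most
    \<open>A * exp (x / (4 * d))\<close>, half of the available exponent \<open>x / (2 * d)\<close>;
    the extra \<open>A\<close> pays for rounding up.\<close>
  define l where "l = nat \<lceil>x / (4 * d * ln A)\<rceil>"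
  have d: "d \<ge> 1" "real (r - 1) = d" using r by (auto simp: d_def of_nat_diff)
  have A: "A > 1" by (simp add: A_def add_pos_pos)
  have y: "0 \<le> y" "y \<le> 1" using d q by (auto simp: y_def intro!: powr_le1)
  have xy: "x = real n * y" by (simp add: x_def y_def d_def)
  \<comment> \<open>Restricting to the support ensures that all edges are \<open>r\<close>-sets, as
    the conversion to loose paths requires.\<close>
  have "{E. real (max_path_length r n E) < x / (4 * d * ln A)} \<inter> set_pmf (random_hypergraph r n q)
      \<subseteq> {E. \<not> path_from E l 1}"
  proof safe
    fix E assume less: "real (max_path_length r n E) < x / (4 * d * ln A)"
      and E: "E \<in> set_pmf (random_hypergraph r n q)" and "path_from E l 1"
    moreover have "E \<subseteq> r_subsets r n" using E set_pmf_random_hypergraph by blast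
    ultimately have "l \<le> max_path_length r n E"
      unfolding le_max_path_length_iff[OF r n]
      using ordered_loose_path_of_path_from[OF _ r, of E n l 1] n by auto
    then have "x / (4 * d * ln A) \<le> real (max_path_length r n E)"
      by (simp add: l_def ceiling_le_iff)
    then show False using less by simp
  qed
  then have "?P {E. real (max_path_length r n E) < x / (4 * d * ln A)} \<le> ?P {E. \<not> path_from E l 1}"
    by (subst measure_Int_set_pmf[symmetric]) (intro measure_pmf.finite_measure_mono, auto)
  also have "\<dots> \<le> A ^ l * exp (- (real (n - 1) * (y / (2 * d))))"
    using prob_not_path_from_le[OF r q, of 1 "n - 1" n l] n unfolding d A_def y_def by simp
  also have "\<dots> \<le> (A * exp (x / (4 * d))) * (exp 1 * exp (- x / (2 * d)))"
  proof (intro mult_mono)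
    have "real l \<le> x / (4 * d * ln A) + 1"
    proof -
      have "0 \<le> x / (4 * d * ln A)" using d A y by (simp add: xy)
      then show ?thesis
        using of_int_ceiling_le_add_one[of "x / (4 * d * ln A)"] by (simp add: l_def)
    qed
    then have "A powr real l \<le> A powr (x / (4 * d * ln A) + 1)" using A by simp
    also have "\<dots> = A * exp (x / (4 * d))" using A by (simp add: powr_add) (simp add: powr_def)
    finally show "A ^ l \<le> A * exp (x / (4 * d))" using A by (simp add: powr_realpow)
    \<comment> \<open>Starting at vertex \<open>1\<close> leaves only \<open>n - 1\<close> further
      vertices; the loss in the exponent is at most \<open>1\<close>.\<close>
    have "y / (2 * d) \<le> 1" using d y by (simp add: field_simps)
    moreover have "real (n - 1) * (y / (2 * d)) = x / (2 * d) - y / (2 * d)"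
      using n by (simp add: xy of_nat_diff field_simps diff_divide_distrib)
    ultimately show "exp (- (real (n - 1) * (y / (2 * d)))) \<le> exp 1 * exp (- x / (2 * d))"
      by (simp add: exp_add[symmetric])
  qed (use A in auto)
  also have "\<dots> = A * exp 1 * (exp (x / (4 * d)) * exp (- x / (2 * d)))" by simp
  also have "exp (x / (4 * d)) * exp (- x / (2 * d)) = exp (- x / (4 * d))"
    using d by (simp add: exp_add[symmetric] field_simps)
  finally show ?thesis by (simp add: A_def d_def)
qed

section \<open>Passage to the limit\<close>

lemma aas_if_prob_compl_le:
  assumes le: "\<forall>\<^sub>F n in sequentially. measure_pmf.prob (M n) {x. \<not> P n x} \<le> b n"
    and b: "b \<longlonglongrightarrow> 0"
  shows "aas M P"
  unfolding aas_def
proof (rule tendsto_sandwich)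
  have "measure_pmf.prob (M n) {x. \<not> P n x} = 1 - measure_pmf.prob (M n) {x. P n x}" for n
    using measure_pmf.prob_compl[of "{x. P n x}" "M n"] by (simp add: Collect_neg_eq Compl_eq_Diff_UNIV)
  then show "\<forall>\<^sub>F n in sequentially. 1 - b n \<le> measure_pmf.prob (M n) {x. P n x}"
    using le by (auto elim!: eventually_mono)
  show "(\<lambda>n. 1 - b n) \<longlonglongrightarrow> 1" using tendsto_diff[OF tendsto_const b, of 1] by simp
qed auto

text \<open>The power of \<open>n\<close> in the denominator is \<open>d\<close> against
  \<open>d / 4\<close>, which outweighs the logarithms. This brings the denser regime under the
  lower bound assumed in the sparser one.\<close>

lemma log_power_bigo_sqrt_log:
  fixes d :: nat
  assumes "d \<ge> 1"
  shows "(\<lambda>n. ln (real n) ^ d / real n ^ d) \<in> O(\<lambda>n. sqrt (ln (real n)) / real n powr (real d / 4))"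
proof -
  have d: "real d > 0" using assms by simp
  have "(\<lambda>n. ln (real n) powr real d / real n powr real d) \<in>
      O(\<lambda>n. sqrt (ln (real n)) / real n powr (real d / 4))"
    using d by real_asymp
  moreover have "\<forall>\<^sub>F n in sequentially. ln (real n) powr real d / real n powr real d =
      ln (real n) ^ d / real n ^ d"
    using eventually_gt_at_top[of 1] by eventually_elim (simp add: powr_realpow)
  ultimately show ?thesis by (subst (asm) landau_o.big.in_cong) auto
qed

text \<open>The lower bound on \<open>p\<close> makes \<open>x n\<close> at least
  \<open>b * ln n\<close>. Then the lower tail vanishes because \<open>x n\<close> tends to
  infinity, and the upper tail because \<open>exp (- C * x n)\<close> cancels the factor
  \<open>n\<close>.\<close>

lemma aas_max_path_length:
  fixes p :: "nat \<Rightarrow> real"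
  assumes r: "r \<ge> 2" and p: "\<And>n. 0 \<le> p n \<and> p n \<le> 1"
    and omega: "p \<in> \<Omega>(\<lambda>n. ln (real n) ^ (r - 1) / real n ^ (r - 1))"
  shows "\<exists>c C. 0 < c \<and> c \<le> C \<and>
           aas (\<lambda>n. random_hypergraph r n (p n))
             (\<lambda>n E. c * (real n * p n powr (1 / (real r - 1))) \<le> real (max_path_length r n E) \<and>
                    real (max_path_length r n E) \<le> C * (real n * p n powr (1 / (real r - 1))))"
proof -
  define d where "d = real r - 1"
  define x where "x n = real n * p n powr (1 / d)" for n
  have d: "d \<ge> 1" "real (r - 1) = d" using r by (auto simp: d_def of_nat_diff)
  obtain a where a: "a > 0"
    and ev: "\<forall>\<^sub>F n in sequentially.
      a * norm (ln (real n) ^ (r - 1) / real n ^ (r - 1)) \<le> norm (p n)"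
    using landau_omega.bigE[OF omega] by blast
  define b where "b = a powr (1 / d)"
  have b: "b > 0" using a by (simp add: b_def)
  have large: "\<forall>\<^sub>F n in sequentially. n > 1 \<and> p n > 0 \<and> b * ln (real n) \<le> x n"
    using ev eventually_gt_at_top[of 1]
  proof eventually_elim
    case (elim n)
    define u where "u = ln (real n) / real n"
    have u: "u > 0" using elim by (simp add: u_def)
    have le: "a * u ^ (r - 1) \<le> p n"
      using elim p[of n] u by (simp add: u_def power_divide)
    then have "p n > 0" using a u by (smt (verit) mult_pos_pos zero_less_power)
    have "b * u = (a * u ^ (r - 1)) powr (1 / d)"
      using a u d by (simp add: b_def powr_mult powr_powr powr_realpow[symmetric])
    also have "\<dots> \<le> p n powr (1 / d)"
      using le a u d by (intro powr_mono2) auto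
    finally have "b * ln (real n) \<le> x n"
      using elim by (simp add: x_def u_def field_simps)
    then show ?case using elim \<open>p n > 0\<close> by simp
  qed
  have x_lim: "filterlim x at_top sequentially"
  proof (rule filterlim_at_top_mono)
    show "filterlim (\<lambda>n. b * ln (real n)) at_top sequentially" using b by real_asymp
    show "\<forall>\<^sub>F n in sequentially. b * ln (real n) \<le> x n" using large by (auto elim: eventually_mono)
  qed
  define A :: real where "A = 1 + exp 2"
  define c where "c = 1 / (4 * d * ln A)"
  \<comment> \<open>\<open>exp 2\<close> is what the first-moment bound needs, and
    \<open>1 / b\<close> ensures \<open>C * x n \<ge> ln n\<close>.\<close>
  define C where "C = max (exp 2) (1 / b)"
  have "exp 1 \<le> exp (2::real)" by simp
  then have "exp 1 \<le> A" unfolding A_def by linarith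
  then have lnA: "ln A \<ge> 1" by (subst ln_ge_iff) (auto simp: A_def add_pos_pos)
  have c: "c > 0" "c \<le> 1"
    using d lnA mult_mono[of 1 d 1 "ln A"] by (auto simp: c_def)
  have C: "C \<ge> exp 2" "C * b \<ge> 1"
    using b by (auto simp: C_def max_def field_simps)
  have "c \<le> C" using c C exp_ge_add_one_self[of "2::real"] by linarith
  have bound: "\<forall>\<^sub>F n in sequentially. measure_pmf.prob (random_hypergraph r n (p n))
      {E. \<not> (c * x n \<le> real (max_path_length r n E) \<and> real (max_path_length r n E) \<le> C * x n)} \<le>
      A * exp 1 * exp (- x n / (4 * d)) + 1 / x n"
    using large
  proof eventually_elim
    case (elim n)
    let ?P = "measure_pmf.prob (random_hypergraph r n (p n))"
    have x: "x n > 0" using elim by (simp add: x_def)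
    have "{E. \<not> (c * x n \<le> real (max_path_length r n E) \<and> real (max_path_length r n E) \<le> C * x n)} =
        {E. real (max_path_length r n E) < c * x n} \<union> {E. real (max_path_length r n E) > C * x n}"
      by auto
    then have "?P {E. \<not> (c * x n \<le> real (max_path_length r n E) \<and> real (max_path_length r n E) \<le> C * x n)}
        \<le> ?P {E. real (max_path_length r n E) < c * x n} + ?P {E. real (max_path_length r n E) > C * x n}"
      by (simp only:) (rule measure_Un_le, auto)
    also have "\<dots> \<le> A * exp 1 * exp (- x n / (4 * d)) + exp (- C * x n) * real n / x n"
    proof (rule add_mono)
      show "?P {E. real (max_path_length r n E) < c * x n} \<le> A * exp 1 * exp (- x n / (4 * d))"
        using prob_max_path_length_less_le[of r n "p n"] r p elim
        by (simp add: A_def x_def d_def c_def)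
      show "?P {E. real (max_path_length r n E) > C * x n} \<le> exp (- C * x n) * real n / x n"
        using prob_max_path_length_gt_le[of r n "p n" C] r p elim C by (simp add: x_def d_def)
    qed
    also have "exp (- C * x n) * real n / x n \<le> 1 / x n"
    proof (rule divide_right_mono)
      have "1 * ln (real n) \<le> C * b * ln (real n)" using C elim by (intro mult_right_mono) auto
      also have "\<dots> \<le> C * x n"
        using elim c \<open>c \<le> C\<close> by (simp only: mult.assoc) (intro mult_left_mono, auto)
      finally have "exp (- C * x n) \<le> exp (- ln (real n))" by simp
      also have "\<dots> = 1 / real n" using elim by (simp add: exp_minus inverse_eq_divide)
      finally show "exp (- C * x n) * real n \<le> 1" using elim by (simp add: field_simps)
    qed (use x in simp)
    finally show ?case by simp
  qed
  have "4 * d > 0" using d by simp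
  then have "((\<lambda>t. exp (- t / (4 * d))) \<longlongrightarrow> 0) at_top" "((\<lambda>t::real. 1 / t) \<longlongrightarrow> 0) at_top"
    by real_asymp+
  then have "((\<lambda>t. A * exp 1 * exp (- t / (4 * d)) + 1 / t) \<longlongrightarrow> A * exp 1 * 0 + 0) at_top"
    by (intro tendsto_intros)
  then have "((\<lambda>t. A * exp 1 * exp (- t / (4 * d)) + 1 / t) \<longlongrightarrow> 0) at_top" by simp
  then have "(\<lambda>n. A * exp 1 * exp (- x n / (4 * d)) + 1 / x n) \<longlonglongrightarrow> 0"
    by (rule filterlim_compose[OF _ x_lim])
  then have "aas (\<lambda>n. random_hypergraph r n (p n))
      (\<lambda>n E. c * x n \<le> real (max_path_length r n E) \<and> real (max_path_length r n E) \<le> C * x n)"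
    by (rule aas_if_prob_compl_le[OF bound])
  then show ?thesis
    using c(1) \<open>c \<le> C\<close> unfolding x_def d_def by (intro exI[of _ c] exI[of _ C] conjI)
qed

theorem theorem1p4:
  fixes r :: nat and p :: "nat \<Rightarrow> real"
  assumes "r \<ge> 2"
    and "\<And>n. 0 \<le> p n \<and> p n \<le> 1"
    and "((\<lambda>n. sqrt (ln (real n)) / real n powr ((real r - 1) / 4)) \<in> o(p) \<and>
           p \<in> o(\<lambda>_. 1)) \<or>
         (p \<in> \<Omega>(\<lambda>n. ln (real n) ^ (r - 1) / real n ^ (r - 1)) \<and>
           p \<in> o(\<lambda>n. 1 / real n powr ((real r - 1) / 2)))"
  shows "\<exists>c C. 0 < c \<and> c \<le> C \<and>
           aas (\<lambda>n. random_hypergraph r n (p n))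
             (\<lambda>n E. c * (real n * p n powr (1 / (real r - 1))) \<le> real (max_path_length r n E) \<and>
                    real (max_path_length r n E) \<le> C * (real n * p n powr (1 / (real r - 1))))"
proof (rule aas_max_path_length[OF assms(1,2)])
  show "p \<in> \<Omega>(\<lambda>n. ln (real n) ^ (r - 1) / real n ^ (r - 1))"
    using assms(3)
  proof (elim disjE conjE)
    \<comment> \<open>The other regime has the claim among its assumptions, so only this one needs
      an argument.\<close>
    assume small: "(\<lambda>n. sqrt (ln (real n)) / real n powr ((real r - 1) / 4)) \<in> o(p)"
    have "real (r - 1) = real r - 1" "r - 1 \<ge> 1" using assms(1) by (auto simp: of_nat_diff)
    then have "(\<lambda>n. ln (real n) ^ (r - 1) / real n ^ (r - 1)) \<in>
        O(\<lambda>n. sqrt (ln (real n)) / real n powr ((real r - 1) / 4))"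
      using log_power_bigo_sqrt_log[of "r - 1"] by simp
    then have "(\<lambda>n. ln (real n) ^ (r - 1) / real n ^ (r - 1)) \<in> O(p)"
      using landau_o.big_trans landau_o.small_imp_big[OF small] by blast
    then show ?thesis by (simp add: bigomega_iff_bigo)
  qed
qed

end
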